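(* Let $k\ge 1$ be an integer and $p$ a prime with $p\le k$. Then $$a_p(k)=e_p(k)+\lfloor \log_p k\rfloor .$$
   Context: For a prime $p$ and integer $m$, $\nu_p(m)$ denotes the largest $r$ with $p^r\mid m$, with the convention $\nu_p(0)=\infty$. Let $e_p(k)=\nu_p(k!)$. For integers $n$ define $f_{p,k}(n)=\sum_{j=0}^{k-1}\nu_p(n-j)=\nu_p\big(n(n-1)\cdots(n-k+1)\big)$. Define $a_p(k)$ to be the smallest integer $m\ge 0$ such that whether or not $f_{p,k}(n)\ge 2e_p(k)$ holds depends only on the congruence class of $n$ modulo $p^m$. *)

theory Defs
  imports
    Complex_Main
    "HOL-Library.Extended_Nat"
    "HOL-Computational_Algebra.Primes"
    "HOL-Number_Theory.Cong"
begin

(* The library has multiplicity p 0 = 0, whereas here the valuation of 0 is \<infinity>. *)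
definition nu :: "nat \<Rightarrow> int \<Rightarrow> enat" where
  "nu p m = (if m = 0 then \<infinity> else enat (multiplicity (int p) m))"

definition e_val :: "nat \<Rightarrow> nat \<Rightarrow> nat" where
  "e_val p k = multiplicity p (fact k :: nat)"

definition f_val :: "nat \<Rightarrow> nat \<Rightarrow> int \<Rightarrow> enat" where
  "f_val p k n = (\<Sum>j<k. nu p (n - int j))"

definition determined_mod :: "nat \<Rightarrow> nat \<Rightarrow> nat \<Rightarrow> bool" where
  "determined_mod p k m \<longleftrightarrow>
     (\<forall>n n'. [n = n'] (mod int p ^ m) \<longrightarrow>
        (f_val p k n \<ge> enat (2 * e_val p k) \<longleftrightarrow> f_val p k n' \<ge> enat (2 * e_val p k)))"

definition a_val :: "nat \<Rightarrow> nat \<Rightarrow> nat" where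
  "a_val p k = (LEAST m. determined_mod p k m)"

lemma nu_ge_iff:
  assumes "prime p"
  shows "nu p m \<ge> enat r \<longleftrightarrow> int p ^ r dvd m"
proof (cases "m = 0")
  case False
  have "\<not> is_unit (int p)" using assms by auto
  with False show ?thesis by (simp add: nu_def power_dvd_iff_le_multiplicity)
qed (simp add: nu_def)

lemma nu_fact:
  assumes "prime p"
  shows "nu p (fact k) = enat (e_val p k)"
proof -
  have "int p ^ r dvd fact k \<longleftrightarrow> p ^ r dvd fact k" for r
    by (metis int_dvd_int_iff of_nat_fact of_nat_power)
  moreover have "\<not> is_unit p" using assms not_prime_unit by blast
  ultimately have "multiplicity (int p) (fact k) = multiplicity p (fact k :: nat)"
    by (intro multiplicity_eqI) (simp_all add: multiplicity_dvd power_dvd_iff_le_multiplicity del: power_Suc)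
  thus ?thesis by (simp add: nu_def e_val_def)
qed

lemma nu_mult:
  assumes "prime p"
  shows "nu p (x * y) = nu p x + nu p y"
  using assms by (auto simp: nu_def prime_elem_multiplicity_mult_distrib)

lemma f_val_eq_nu_prod:
  assumes "prime p"
  shows "f_val p k n = nu p (\<Prod>j<k. n - int j)"
  using assms by (induction k) (auto simp: f_val_def nu_mult, simp add: nu_def zero_enat_def)

(* The set minimised in a_val is nonempty, so LEAST denotes a genuine minimum. *)
lemma determined_mod_exists:
  assumes "prime p"
  shows "determined_mod p k (2 * e_val p k)"
  unfolding determined_mod_def
proof (intro allI impI)
  fix n n' :: int
  assume "[n = n'] (mod int p ^ (2 * e_val p k))"
  then have "[(\<Prod>j<k. n - int j) = (\<Prod>j<k. n' - int j)] (mod int p ^ (2 * e_val p k))"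
    by (intro cong_prod cong_diff) auto
  then show "f_val p k n \<ge> enat (2 * e_val p k) \<longleftrightarrow> f_val p k n' \<ge> enat (2 * e_val p k)"
    using assms by (simp add: f_val_eq_nu_prod nu_ge_iff cong_dvd_iff)
qed

lemma determined_mod_a_val:
  assumes "prime p"
  shows "determined_mod p k (a_val p k)"
  unfolding a_val_def using determined_mod_exists[OF assms] by (rule LeastI)

end

theory Submission
  imports Defs
begin

text \<open>
  Let \<open>p ^ L \<le> k < p ^ (L + 1)\<close> and \<open>e = e_val p k\<close>.  If \<open>p ^ (L + e)\<close> divides none of the factors
  \<open>n - j\<close>, their valuations, hence \<open>f_val p k n\<close>, depend only on \<open>n\<close> modulo \<open>p ^ (L + e)\<close>.
  If it divides \<open>M = n - j\<close>, the remaining factors \<open>M \<plusminus> i\<close> have the valuations of \<open>i\<close>, so that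
  \<open>f_val p k n \<ge> (L + e) + e_val p j + e_val p (k - 1 - j) \<ge> 2 * e\<close> by Legendre's formula.
  For minimality, \<open>n = p ^ L - 1\<close> has a vanishing factor, whereas for \<open>n = p ^ (L + e - 1) + p ^ L - 1\<close>
  which is congruent to it modulo \<open>p ^ (L + e - 1)\<close>, the last inequality loses nothing: with
  \<open>j = p ^ L - 1\<close> one has \<open>e = L + e_val p j + e_val p (k - 1 - j)\<close>, so \<open>f_val p k n = 2 * e - 1\<close>.
\<close>

section \<open>Legendre's formula and its behaviour under k = j + 1 + (k - 1 - j)\<close>

lemma multiplicity_eq_card:
  fixes p n :: nat
  assumes "prime p" "0 < n" "n < p ^ Suc L"
  shows "multiplicity p n = card {i \<in> {1..L}. p ^ i dvd n}"
proof -
  have nu: "\<not> is_unit p" using assms(1) not_prime_unit by blast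
  have iff: "p ^ i dvd n \<longleftrightarrow> i \<le> multiplicity p n" for i
    using nu assms(2) by (intro power_dvd_iff_le_multiplicity) auto
  have "p ^ multiplicity p n \<le> n"
    using assms(2) by (intro dvd_imp_le multiplicity_dvd)
  then have "p ^ multiplicity p n < p ^ Suc L" using assms(3) by linarith
  then have "multiplicity p n \<le> L"
    using power_less_imp_less_exp prime_gt_1_nat[OF assms(1)] by (metis less_Suc_eq_le)
  then have "{i \<in> {1..L}. p ^ i dvd n} = {1..multiplicity p n}" unfolding iff by auto
  then show ?thesis by simp
qed

lemma e_val_0: "e_val p 0 = 0" by (simp add: e_val_def)

lemma e_val_Suc:
  assumes "prime p"
  shows "e_val p (Suc n) = multiplicity p (Suc n) + e_val p n"
  unfolding e_val_def fact_Suc of_nat_id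
  using assms by (intro prime_elem_multiplicity_mult_distrib) auto

text \<open>By induction: passing from \<open>n\<close> to \<open>Suc n\<close> raises
  \<open>n div p ^ i\<close> by one exactly when \<open>p ^ i\<close> divides \<open>Suc n\<close>,
  and \<open>multiplicity_eq_card\<close> counts these \<open>i\<close>. A cut-off \<open>L\<close>
  given in advance lets \<open>k\<close>, \<open>j\<close> and \<open>k - 1 - j\<close> be compared
  term by term.\<close>

lemma legendre_formula:
  assumes "prime p" "n < p ^ Suc L"
  shows "e_val p n = (\<Sum>i=1..L. n div p ^ i)"
  using assms(2)
proof (induction n)
  case 0
  show ?case by (simp add: e_val_0)
next
  case (Suc n)
  have "card {i \<in> {1..L}. p ^ i dvd Suc n} = (\<Sum>i=1..L. if p ^ i dvd Suc n then 1 else 0)"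
    by (simp add: sum.If_cases Int_def)
  then have "e_val p (Suc n) = (\<Sum>i=1..L. (if p ^ i dvd Suc n then 1 else 0) + n div p ^ i)"
    using Suc assms(1) by (simp add: e_val_Suc multiplicity_eq_card sum.distrib)
  also have "\<dots> = (\<Sum>i=1..L. Suc n div p ^ i)"
    by (intro sum.cong refl) (auto simp: div_Suc dvd_eq_mod_eq_0)
  finally show ?case .
qed

text \<open>Termwise in Legendre's formula with \<open>q = p ^ i\<close>: in k = j + (k - 1 - j) + 1
  the two remainders modulo \<open>q\<close> and the extra 1 add up to less than 2q, so each of the
  \<open>L\<close> quotients gains at most 1.\<close>

lemma e_val_split_le:
  assumes "prime p" "j < k" "k < p ^ Suc L"
  shows "e_val p k \<le> L + e_val p j + e_val p (k - 1 - j)"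
proof -
  have *: "k div q \<le> 1 + j div q + (k - 1 - j) div q" if "0 < q" for q
  proof -
    let ?c = "k - 1 - j"
    have "q * (j div q) + j mod q = j" "q * (?c div q) + ?c mod q = ?c" by auto
    moreover have "j mod q < q" "?c mod q < q" using that by auto
    ultimately have "k < q + q + q * (j div q) + q * (?c div q)" using assms(2) by linarith
    then have "k < q * (2 + j div q + ?c div q)" by (simp add: algebra_simps)
    then show ?thesis using that by (simp add: div_less_iff_less_mult mult.commute flip: less_Suc_eq_le)
  qed
  have "e_val p k = (\<Sum>i=1..L. k div p ^ i)" using assms by (simp add: legendre_formula)
  also have "\<dots> \<le> (\<Sum>i=1..L. 1 + j div p ^ i + (k - 1 - j) div p ^ i)"
    using prime_gt_0_nat[OF assms(1)] by (intro sum_mono *) simp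
  also have "\<dots> = L + (\<Sum>i=1..L. j div p ^ i) + (\<Sum>i=1..L. (k - 1 - j) div p ^ i)"
    by (simp only: sum.distrib) simp
  also have "\<dots> = L + e_val p j + e_val p (k - 1 - j)"
    using assms by (simp add: legendre_formula[OF assms(1), of _ L])
  finally show ?thesis .
qed

text \<open>Equality case \<open>j = p ^ L - 1\<close> of \<open>e_val_split_le\<close>: for
  \<open>i\<close> up to \<open>L\<close> the remainder of \<open>p ^ L - 1\<close> modulo
  \<open>p ^ i\<close> is \<open>p ^ i - 1\<close>, the largest possible, so each of the
  \<open>L\<close> quotients gains exactly 1.\<close>

lemma e_val_split_eq:
  assumes "prime p" "p ^ L \<le> k" "k < p ^ Suc L"
  shows "e_val p k = L + e_val p (p ^ L - 1) + e_val p (k - p ^ L)"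
proof -
  have p0: "0 < p" by (rule prime_gt_0_nat[OF assms(1)])
  have *: "k div p ^ i = 1 + (p ^ L - 1) div p ^ i + (k - p ^ L) div p ^ i" if "i \<in> {1..L}" for i
  proof -
    have "p ^ i dvd p ^ L" using that by (intro le_imp_power_dvd) simp
    then obtain d where d: "p ^ L = p ^ i * d" by (rule dvdE)
    have "0 < d" using d p0 by (metis mult_0_right neq0_conv power_not_zero)
    then obtain c where c: "d = Suc c" by (cases d) auto
    have "p ^ L - 1 = (p ^ i - 1) + p ^ i * c" using d c p0 by (simp add: add.commute)
    then have "(p ^ L - 1) div p ^ i = c + (p ^ i - 1) div p ^ i"
      using p0 by (simp only:) (intro div_mult_self2, simp)
    then have "(p ^ L - 1) div p ^ i = c" using p0 by simp
    moreover have "((k - p ^ L) + p ^ i * d) div p ^ i = d + (k - p ^ L) div p ^ i"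
      using p0 by (intro div_mult_self2) simp
    then have "k div p ^ i = d + (k - p ^ L) div p ^ i" using assms(2) by (simp flip: d)
    ultimately show ?thesis using c by simp
  qed
  have "p ^ L - 1 < p ^ Suc L" "k - p ^ L < p ^ Suc L" using assms by auto
  moreover have "(\<Sum>i=1..L. k div p ^ i) = (\<Sum>i=1..L. 1 + (p ^ L - 1) div p ^ i + (k - p ^ L) div p ^ i)"
    by (intro sum.cong * refl)
  moreover have "\<dots> = L + (\<Sum>i=1..L. (p ^ L - 1) div p ^ i) + (\<Sum>i=1..L. (k - p ^ L) div p ^ i)"
    by (simp only: sum.distrib) simp
  ultimately show ?thesis
    using legendre_formula[OF assms(1), of _ L] assms(3) by simp
qed

section \<open>Valuations of the factors near a multiple of a prime power\<close>

lemma nu_eqI: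
  assumes "prime p" "\<And>r. int p ^ r dvd x \<longleftrightarrow> int p ^ r dvd y"
  shows "nu p x = nu p y"
proof (rule order.antisym)
  have "nu p u \<le> nu p v" if "\<And>r. int p ^ r dvd u \<longleftrightarrow> int p ^ r dvd v" for u v
  proof (cases "nu p v")
    case (enat m)
    then have "\<not> int p ^ Suc m dvd v" using nu_ge_iff[OF assms(1), of "Suc m" v] by (simp del: power_Suc)
    then have "\<not> enat (Suc m) \<le> nu p u" using that nu_ge_iff[OF assms(1), of "Suc m" u] by (simp del: power_Suc)
    then show ?thesis using enat by (cases "nu p u") auto
  qed simp
  then show "nu p x \<le> nu p y" "nu p y \<le> nu p x" using assms(2) by auto
qed

text \<open>Divisibility by \<open>p ^ r\<close> with \<open>r \<le> a\<close> is visible modulo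
  \<open>p ^ a\<close>; for larger \<open>r\<close> it fails on both sides.\<close>

lemma nu_cong:
  assumes "prime p" "[x = y] (mod int p ^ a)" "\<not> int p ^ a dvd x"
  shows "nu p x = nu p y"
proof (rule nu_eqI[OF assms(1)])
  fix r
  show "int p ^ r dvd x \<longleftrightarrow> int p ^ r dvd y"
  proof (cases "r \<le> a")
    case True
    then have "[x = y] (mod int p ^ r)" using assms(2) cong_dvd_modulus le_imp_power_dvd by blast
    then show ?thesis by (rule cong_dvd_iff)
  next
    case False
    then have "int p ^ a dvd int p ^ r" by (intro le_imp_power_dvd) simp
    moreover have "\<not> int p ^ a dvd y" using assms(2,3) cong_dvd_iff by blast
    ultimately show ?thesis using assms(3) dvd_trans by blast
  qed
qed

lemma sum_nu_eq_e_val: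
  assumes "prime p"
  shows "(\<Sum>i<m. nu p (int (Suc i))) = enat (e_val p m)"
proof -
  have "(\<Sum>i<m. nu p (int (Suc i))) = nu p (fact m)"
    using assms by (induction m) (simp_all add: nu_mult mult.commute, simp add: nu_def zero_enat_def)
  then show ?thesis using assms by (simp add: nu_fact)
qed

text \<open>Recentres the product at its factor M = n - j, with j factors above it and k - 1 - j
  below; near a multiple of a high power of p these two groups behave like factorials.\<close>

lemma f_val_split:
  assumes "j < k"
  shows "f_val p k (M + int j) =
    nu p M + (\<Sum>i<j. nu p (M + int (Suc i))) + (\<Sum>i<k - 1 - j. nu p (M - int (Suc i)))"
proof -
  obtain c where k: "k = Suc j + c" using assms less_imp_Suc_add by auto
  have "f_val p k (M + int j) =
      (\<Sum>i<Suc j. nu p (M + int j - int i)) + (\<Sum>i<c. nu p (M + int j - int (Suc j + i)))"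
    unfolding f_val_def k by (induction c) (simp_all add: add.assoc)
  also have "(\<Sum>i<Suc j. nu p (M + int j - int i)) = (\<Sum>i<Suc j. nu p (M + int i))"
    by (rule sum.reindex_bij_witness[of _ "\<lambda>i. j - i" "\<lambda>i. j - i"]) (auto simp: of_nat_diff add_diff_eq)
  also have "\<dots> = nu p M + (\<Sum>i<j. nu p (M + int (Suc i)))"
    by (subst sum.lessThan_Suc_shift) simp
  finally show ?thesis by (simp add: k algebra_simps)
qed

text \<open>Modulo \<open>p ^ a\<close> the neighbours M + i and M - i are i and -i; by
  \<open>small\<close> and \<open>nu_cong\<close> they have the valuation of i, which leaves j! and
  (k - 1 - j)!. M itself may be 0, with valuation \<infinity>.\<close>

lemma f_val_eq_near_multiple:
  assumes "prime p" "j < k" "int p ^ a dvd M"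
    and small: "\<And>i. 0 < i \<Longrightarrow> i \<le> j \<or> i \<le> k - 1 - j \<Longrightarrow> \<not> p ^ a dvd i"
  shows "f_val p k (M + int j) = nu p M + enat (e_val p j + e_val p (k - 1 - j))"
proof -
  have nd: "\<not> int p ^ a dvd int (Suc i)" if "i < j \<or> i < k - 1 - j" for i
  proof -
    have "\<not> p ^ a dvd Suc i" using that by (intro small) auto
    then show ?thesis by (metis int_dvd_int_iff of_nat_power)
  qed
  have "nu p (M + int (Suc i)) = nu p (int (Suc i))" if "i < j" for i
  proof (rule sym, rule nu_cong[OF assms(1)])
    show "[int (Suc i) = M + int (Suc i)] (mod int p ^ a)"
      using assms(3) by (simp add: cong_iff_dvd_diff)
  qed (use nd that in blast)
  moreover have "nu p (M - int (Suc i)) = nu p (int (Suc i))" if "i < k - 1 - j" for i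
  proof -
    have "nu p (M - int (Suc i)) = nu p (- int (Suc i))"
    proof (rule sym, rule nu_cong[OF assms(1)])
      show "[- int (Suc i) = M - int (Suc i)] (mod int p ^ a)"
        using assms(3) by (simp add: cong_iff_dvd_diff)
      show "\<not> int p ^ a dvd - int (Suc i)" using nd that dvd_minus_iff by blast
    qed
    also have "\<dots> = nu p (int (Suc i))" by (rule nu_eqI[OF assms(1)]) (rule dvd_minus_iff)
    finally show ?thesis .
  qed
  ultimately show ?thesis
    using sum_nu_eq_e_val[OF assms(1)]
    by (simp add: f_val_split[OF assms(2)] add.assoc flip: plus_enat_simps del: of_nat_Suc)
qed

section \<open>The upper and the lower bound for the exponent\<close>

lemma e_val_ge_div:
  assumes "prime p"
  shows "k div p \<le> e_val p k"
proof -
  \<comment> \<open>Any sufficiently large cut-off serves; \<open>Suc k\<close> is at least 1 even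
    for \<open>k = 0\<close>, so the term with i = 1 is present.\<close>
  have "k < p ^ k" using prime_gt_1_nat[OF assms] by (simp add: power_gt_expt)
  also have "\<dots> < p ^ Suc (Suc k)" using prime_gt_1_nat[OF assms] by (intro power_strict_increasing) auto
  finally have "e_val p k = (\<Sum>i=1..Suc k. k div p ^ i)" by (rule legendre_formula[OF assms])
  also have "\<dots> \<ge> (\<Sum>i\<in>{1}. k div p ^ i)" by (rule sum_mono2) auto
  finally show ?thesis by simp
qed

lemma determined_mod_upper:
  assumes "prime p" "p \<le> k" "k < p ^ Suc L"
  shows "determined_mod p k (e_val p k + L)"
proof -
  define a where "a = e_val p k + L"
  \<comment> \<open>A positive \<open>e_val p k\<close> gives \<open>Suc L \<le> a\<close>, hence
    \<open>k < p ^ a\<close>, so that no distance between two factors is a nonzero multiple of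
    \<open>p ^ a\<close>.\<close>
  have "1 \<le> k div p" using assms(2) prime_gt_0_nat[OF assms(1)] by (simp add: div_greater_zero_iff Suc_le_eq)
  then have e1: "1 \<le> e_val p k" using e_val_ge_div[OF assms(1)] order.trans by blast
  have ka: "k < p ^ a"
  proof -
    have "p ^ Suc L \<le> p ^ a"
      using e1 prime_gt_0_nat[OF assms(1)] by (intro power_increasing) (auto simp: a_def)
    then show ?thesis using assms(3) by linarith
  qed
  have ge: "enat (2 * e_val p k) \<le> f_val p k n" if "j < k" "int p ^ a dvd n - int j" for n j
  proof -
    have "f_val p k (n - int j + int j) = nu p (n - int j) + enat (e_val p j + e_val p (k - 1 - j))"
    proof (rule f_val_eq_near_multiple[OF assms(1) that])
      fix i assume "0 < i" "i \<le> j \<or> i \<le> k - 1 - j"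
      then have "i < p ^ a" using ka that(1) by linarith
      then show "\<not> p ^ a dvd i" using \<open>0 < i\<close> nat_dvd_not_less by blast
    qed
    moreover have "enat a \<le> nu p (n - int j)" using that(2) nu_ge_iff[OF assms(1)] by blast
    ultimately have "enat a + enat (e_val p j + e_val p (k - 1 - j)) \<le> f_val p k n"
      by (simp add: add_right_mono del: plus_enat_simps)
    moreover have "2 * e_val p k \<le> a + (e_val p j + e_val p (k - 1 - j))"
      using e_val_split_le[OF assms(1) that(1) assms(3)] by (simp add: a_def)
    ultimately show ?thesis by (metis enat_ord_simps(1) order.trans plus_enat_simps(1))
  qed
  have "enat (2 * e_val p k) \<le> f_val p k n \<longleftrightarrow> enat (2 * e_val p k) \<le> f_val p k n'"
    if cong: "[n = n'] (mod int p ^ a)" for n n'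
  \<comment> \<open>A factor divisible by \<open>p ^ a\<close> stays so when passing to
    \<open>n'\<close>, and \<open>ge\<close> makes both sides true; otherwise \<open>nu_cong\<close>
    matches the valuations factor by factor.\<close>
  proof (cases "\<exists>j<k. int p ^ a dvd n - int j")
    case True
    then obtain j where j: "j < k" "int p ^ a dvd n - int j" by blast
    have "[n - int j = n' - int j] (mod int p ^ a)" using cong by (intro cong_diff) auto
    then have "int p ^ a dvd n' - int j" using j(2) cong_dvd_iff by blast
    then show ?thesis using ge j by blast
  next
    case False
    have "nu p (n - int j) = nu p (n' - int j)" if "j < k" for j
      using False that cong by (intro nu_cong[OF assms(1), of _ _ a] cong_diff) auto
    then show ?thesis by (simp add: f_val_def)
  qed
  then show ?thesis by (auto simp: determined_mod_def a_def)
qed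

lemma determined_mod_lower:
  assumes "prime p" "1 \<le> L" "p ^ L \<le> k" "k < p ^ Suc L" "determined_mod p k m"
  shows "e_val p k + L \<le> m"
proof (rule ccontr)
  define e where "e = e_val p k"
  have p1: "1 < p" by (rule prime_gt_1_nat[OF assms(1)])
  \<comment> \<open>The largest exponent below the claimed bound, and the \<open>j\<close> at which
    \<open>e_val_split_eq\<close> is exact.\<close>
  define a where "a = e + L - 1"
  define j where "j = p ^ L - 1"
  assume "\<not> e_val p k + L \<le> m"
  then have ma: "m \<le> a" and "Suc a = e + L" using assms(2) by (auto simp: a_def e_def)
  have "0 < p ^ L" using p1 by simp
  then have jk: "j < k" using assms(3) unfolding j_def by linarith
  have "p ^ 1 \<le> p ^ L" using assms(2) p1 by (intro power_increasing) auto
  then have pL: "p \<le> p ^ L" by simp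
  have "1 \<le> k div p" using p1 pL assms(3) by (simp add: div_greater_zero_iff Suc_le_eq)
  then have e1: "1 \<le> e" using e_val_ge_div[OF assms(1)] order.trans by (auto simp: e_def)
  have kj: "k - 1 - j = k - p ^ L" using p1 by (simp add: j_def)
  \<comment> \<open>As \<open>j < p ^ L \<le> p ^ a\<close>, only some
    \<open>i \<le> k - p ^ L\<close> could reach \<open>p ^ a\<close>. Then k is at least 2p, so
    \<open>e\<close> is at least 2 and \<open>p ^ a \<ge> p ^ Suc L > k\<close>, a contradiction.
    This covers the tight case e = 1, where a = L.\<close>
  have small: "\<not> p ^ a dvd i" if "0 < i" "i \<le> j \<or> i \<le> k - 1 - j" for i
  proof
    assume "p ^ a dvd i"
    then have le: "p ^ a \<le> i" using that(1) dvd_imp_le by blast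
    moreover have "p ^ L \<le> p ^ a" using e1 p1 by (intro power_increasing) (auto simp: a_def)
    moreover have "j < p ^ L" using p1 by (simp add: j_def)
    ultimately have i: "i \<le> k - p ^ L" "p ^ L \<le> i" using that(2) kj by linarith+
    then have "2 * p \<le> k" using assms(3) pL by linarith
    then have "2 \<le> k div p" using p1 by (simp add: less_eq_div_iff_mult_less_eq)
    then have "2 \<le> e" using e_val_ge_div[OF assms(1)] order.trans by (auto simp: e_def)
    then have "p ^ Suc L \<le> p ^ a" using p1 by (intro power_increasing) (auto simp: a_def)
    then show False using le i assms(4) by linarith
  qed
  have f1: "f_val p k (int p ^ a + int j) = nu p (int p ^ a) + enat (e_val p j + e_val p (k - 1 - j))"
    using small by (intro f_val_eq_near_multiple[OF assms(1) jk]) auto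
  have f0: "f_val p k (0 + int j) = nu p 0 + enat (e_val p j + e_val p (k - 1 - j))"
    using small by (intro f_val_eq_near_multiple[OF assms(1) jk]) auto
  have "nu p (int p ^ a) = enat a" using p1 by (simp add: nu_def multiplicity_same_power)
  moreover have "e = L + e_val p j + e_val p (k - 1 - j)"
    unfolding e_def kj unfolding j_def by (rule e_val_split_eq[OF assms(1,3,4)])
  \<comment> \<open>The sum is (e + L - 1) + (e - L), one short of the threshold.\<close>
  then have "a + (e_val p j + e_val p (k - 1 - j)) = 2 * e - 1"
    using \<open>Suc a = e + L\<close> by linarith
  ultimately have "f_val p k (int p ^ a + int j) = enat (2 * e - 1)" using f1 by simp
  then have "\<not> enat (2 * e) \<le> f_val p k (int p ^ a + int j)" using e1 by simp
  \<comment> \<open>Here n = j < k, so the factor n - j is 0 and contributes \<infinity>.\<close>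
  moreover have "enat (2 * e) \<le> f_val p k (0 + int j)" unfolding f0 by (simp add: nu_def)
  moreover have "[int p ^ a + int j = 0 + int j] (mod int p ^ m)"
    using ma by (simp add: cong_iff_dvd_diff le_imp_power_dvd)
  ultimately show False using assms(5) unfolding determined_mod_def e_def by blast
qed

theorem theorem2:
  fixes p k :: nat
  assumes "k \<ge> 1" and "prime p" and "p \<le> k"
  shows "int (a_val p k) = int (e_val p k) + \<lfloor>log (real p) (real k)\<rfloor>"
proof -
  have p2: "2 \<le> p" using assms(2) by (rule prime_ge_2_nat)
  then obtain L where L: "p ^ L \<le> k" "k < p ^ Suc L"
    using ex_power_ivl1[of p k] assms(1) by auto
  \<comment> \<open>\<open>p \<le> k\<close> rules out \<open>L = 0\<close>, a case not covered by
    \<open>determined_mod_lower\<close>.\<close>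
  have "L \<noteq> 0" using L assms(3) by (intro notI) simp
  then have "1 \<le> L" by simp
  then have "a_val p k = e_val p k + L"
    unfolding a_val_def using assms L
    by (intro Least_equality determined_mod_upper determined_mod_lower) auto
  moreover have "\<lfloor>log (real p) (real k)\<rfloor> = int L"
    using floor_log_nat_eq_if[of p L k] L p2 by simp
  ultimately show ?thesis by simp
qed

end
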